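(* The price of stability in super-strong equilibria of financial network games under priority-proportional strategies is unbounded when negative external assets are allowed and firms aim to maximize their equity: for every $R>0$ there is a financial network with debt contracts only, real (possibly negative) external assets and no default costs, whose game has at least one super-strong equilibrium and whose price of stability in super-strong equilibria is at least $R$.
   Context: Financial network: firms $v_1,\dots,v_n$; each $v_i$ has external assets $e_i\in\mathbb{R}$, possibly negative (a negative value represents an obligation to entities outside the network, which absorbs incoming payments first); $v_i$ owes $v_j$ the liability $l_{ij}\ge 0$, with $l_{ii}=0$ (both $l_{ij}>0$ and $l_{ji}>0$ are allowed); $L_i=\sum_j l_{ij}$. Priority-proportional strategy: a strategy $s_i$ of $v_i$ is a complete ordering, allowing ties, of its creditors, i.e. an ordered partition of $\{v_j: l_{ij}>0\}$ into priority classes $1,2,\dots$. Write $L_i^{(m)}$ for the total liability of $v_i$ to its $m$-th class, $k_{ij}$ for the index of the class of $v_i$ containing $v_j$, and $\pi'_{ij}=l_{ij}/L_i^{(k_{ij})}$. Clearing payments consistent with a strategy profile $\mathbf{s}=(s_1,\dots,s_n)$: a matrix $\mathbf{P}=(p_{ij})$ with $p_{ii}=0$, $0\le p_{ij}\le l_{ij}$ and, writing $p_i=\sum_j p_{ij}$, for every $i$: $p_i=L_i$ if $L_i\le e_i+\sum_j p_{ji}$, and $p_i=\max\{0,\,e_i+\sum_j p_{ji}\}$ otherwise; moreover for every creditor $v_j$ of $v_i$, $$p_{ij}=\min\Big\{\max\Big\{\Big(p_i-\sum_{m=1}^{k_{ij}-1}L_i^{(m)}\Big)\pi'_{ij},\,0\Big\},\,l_{ij}\Big\},$$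 and $p_{ij}=0$ if $l_{ij}=0$. Clearing payments are proper if every firm with a positive outgoing payment is reachable, by a (possibly trivial) directed path of edges $(v_i,v_j)$ with $p_{ij}>0$, from some firm with positive external assets. Only proper clearing payments are considered. For every profile $\mathbf{s}$ there are maximal ones, denoted $\mathbf{P}(\mathbf{s})$, which are entrywise at least as large as all other proper clearing payments consistent with $\mathbf{s}$. Equity: $E_i(\mathbf{P})=\max\{0,\ e_i+\sum_j p_{ji}-L_i\}$. The utility of $v_i$ under $\mathbf{s}$ is $E_i(\mathbf{P}(\mathbf{s}))$. A profile is a super-strong equilibrium if no coalition of firms can jointly change their strategies (the other firms' strategies being fixed) so that at least one member of the coalition strictly increases its utility and no member suffers a decrease in utility. Social welfare: $SW(\mathbf{P})=\sum_i E_i(\mathbf{P})$; $OPT$ is the maximum of $SW(\mathbf{P}(\mathbf{s}))$ over all strategy profiles. The price of stability in super-strong equilibria of an instance is the minimum of $OPT/SW(\mathbf{P}(\mathbf{s}))$ over super-strong equilibria $\mathbf{s}$ (with $0/0=1$ and $x/0=+\infty$ for $x>0$). *)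

theory Defs
  imports "HOL-Library.Extended_Real" "HOL-Library.FuncSet" "HOL-Library.Disjoint_Sets"
begin

section \<open>Financial networks\<close>

text \<open>The firms are the numbers below \<open>firms N\<close>; values of \<open>ext N\<close> and \<open>liab N\<close> outside this
  range are never used.\<close>

record network =
  firms :: nat
  ext :: "nat \<Rightarrow> real"
  liab :: "nat \<Rightarrow> nat \<Rightarrow> real"

definition financial_network :: "network \<Rightarrow> bool" where
  "financial_network N \<longleftrightarrow>
     (\<forall>i<firms N. \<forall>j<firms N. 0 \<le> liab N i j) \<and> (\<forall>i<firms N. liab N i i = 0)"

definition total_liab :: "network \<Rightarrow> nat \<Rightarrow> real" where
  "total_liab N i = (\<Sum>j<firms N. liab N i j)"

definition creditors :: "network \<Rightarrow> nat \<Rightarrow> nat set" where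
  "creditors N i = {j. j < firms N \<and> 0 < liab N i j}"

section \<open>Priority-proportional strategies\<close>

text \<open>A strategy is the list of its priority classes, highest priority first. Classes are numbered
  from 0 here, so \<open>ss ! m\<close> is the class with number \<open>m + 1\<close> in the usual counting.\<close>

definition strategies :: "network \<Rightarrow> nat \<Rightarrow> nat set list set" where
  "strategies N i = {ss. distinct ss \<and> partition_on (creditors N i) (set ss)}"

text \<open>Profiles are extensional functions, so that distinct elements differ at some firm.\<close>

definition profiles :: "network \<Rightarrow> (nat \<Rightarrow> nat set list) set" where
  "profiles N = (\<Pi>\<^sub>E i\<in>{..<firms N}. strategies N i)"

definition class_idx :: "nat set list \<Rightarrow> nat \<Rightarrow> nat" where
  "class_idx ss j = (THE m. m < length ss \<and> j \<in> ss ! m)"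

definition class_liab :: "network \<Rightarrow> nat \<Rightarrow> nat set list \<Rightarrow> nat \<Rightarrow> real" where
  "class_liab N i ss m = (\<Sum>j\<in>ss ! m. liab N i j)"

definition allocation :: "network \<Rightarrow> nat \<Rightarrow> nat set list \<Rightarrow> real \<Rightarrow> nat \<Rightarrow> real" where
  "allocation N i ss p j =
     min (max ((p - (\<Sum>m<class_idx ss j. class_liab N i ss m))
               * (liab N i j / class_liab N i ss (class_idx ss j))) 0) (liab N i j)"

section \<open>Clearing payments\<close>

definition assets :: "network \<Rightarrow> (nat \<Rightarrow> nat \<Rightarrow> real) \<Rightarrow> nat \<Rightarrow> real" where
  "assets N P i = ext N i + (\<Sum>j<firms N. P j i)"

definition outgoing :: "network \<Rightarrow> (nat \<Rightarrow> nat \<Rightarrow> real) \<Rightarrow> nat \<Rightarrow> real" where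
  "outgoing N P i = (\<Sum>j<firms N. P i j)"

text \<open>The first conjunct fixes the payment matrix outside the index range, which makes entrywise
  maximal clearing payments unique as functions.\<close>

definition clearing :: "network \<Rightarrow> (nat \<Rightarrow> nat set list) \<Rightarrow> (nat \<Rightarrow> nat \<Rightarrow> real) \<Rightarrow> bool" where
  "clearing N s P \<longleftrightarrow>
     (\<forall>i j. \<not> (i < firms N \<and> j < firms N) \<longrightarrow> P i j = 0) \<and>
     (\<forall>i<firms N. P i i = 0) \<and>
     (\<forall>i<firms N. \<forall>j<firms N. 0 \<le> P i j \<and> P i j \<le> liab N i j) \<and>
     (\<forall>i<firms N. outgoing N P i =
        (if total_liab N i \<le> assets N P i then total_liab N i else max 0 (assets N P i))) \<and>
     (\<forall>i<firms N. \<forall>j<firms N. P i j =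
        (if j \<in> creditors N i then allocation N i (s i) (outgoing N P i) j else 0))"

definition pay_edges :: "network \<Rightarrow> (nat \<Rightarrow> nat \<Rightarrow> real) \<Rightarrow> (nat \<times> nat) set" where
  "pay_edges N P = {(i, j). i < firms N \<and> j < firms N \<and> 0 < P i j}"

definition proper :: "network \<Rightarrow> (nat \<Rightarrow> nat \<Rightarrow> real) \<Rightarrow> bool" where
  "proper N P \<longleftrightarrow>
     (\<forall>i<firms N. 0 < outgoing N P i \<longrightarrow>
        (\<exists>k<firms N. 0 < ext N k \<and> (k, i) \<in> (pay_edges N P)\<^sup>*))"

definition is_max_clearing ::
    "network \<Rightarrow> (nat \<Rightarrow> nat set list) \<Rightarrow> (nat \<Rightarrow> nat \<Rightarrow> real) \<Rightarrow> bool" where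
  "is_max_clearing N s P \<longleftrightarrow>
     clearing N s P \<and> proper N P \<and>
     (\<forall>Q. clearing N s Q \<and> proper N Q \<longrightarrow> (\<forall>i j. Q i j \<le> P i j))"

text \<open>Existence and uniqueness are shown in \<open>ex1_max_clearing\<close> below.\<close>

definition payments :: "network \<Rightarrow> (nat \<Rightarrow> nat set list) \<Rightarrow> nat \<Rightarrow> nat \<Rightarrow> real" where
  "payments N s = (THE P. is_max_clearing N s P)"

section \<open>The game\<close>

definition equity :: "network \<Rightarrow> (nat \<Rightarrow> nat \<Rightarrow> real) \<Rightarrow> nat \<Rightarrow> real" where
  "equity N P i = max 0 (assets N P i - total_liab N i)"

definition utility :: "network \<Rightarrow> (nat \<Rightarrow> nat set list) \<Rightarrow> nat \<Rightarrow> real" where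
  "utility N s i = equity N (payments N s) i"

definition super_strong_eq :: "network \<Rightarrow> (nat \<Rightarrow> nat set list) \<Rightarrow> bool" where
  "super_strong_eq N s \<longleftrightarrow>
     s \<in> profiles N \<and>
     \<not> (\<exists>C s'. C \<subseteq> {..<firms N} \<and> s' \<in> profiles N \<and>
            (\<forall>i<firms N. i \<notin> C \<longrightarrow> s' i = s i) \<and>
            (\<exists>i\<in>C. utility N s i < utility N s' i) \<and>
            (\<forall>i\<in>C. utility N s i \<le> utility N s' i))"

definition social_welfare :: "network \<Rightarrow> (nat \<Rightarrow> nat \<Rightarrow> real) \<Rightarrow> real" where
  "social_welfare N P = (\<Sum>i<firms N. equity N P i)"

text \<open>The sets under \<open>Max\<close> and \<open>Min\<close> below are finite by \<open>finite_profiles\<close>.\<close>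

definition opt_welfare :: "network \<Rightarrow> real" where
  "opt_welfare N = Max ((\<lambda>s. social_welfare N (payments N s)) ` profiles N)"

definition welfare_ratio :: "real \<Rightarrow> real \<Rightarrow> ereal" where
  "welfare_ratio x y = (if y = 0 then (if x = 0 then 1 else \<infinity>) else ereal (x / y))"

text \<open>Only meaningful if a super-strong equilibrium exists.\<close>

definition price_of_stability :: "network \<Rightarrow> ereal" where
  "price_of_stability N =
     Min ((\<lambda>s. welfare_ratio (opt_welfare N) (social_welfare N (payments N s))) `
          {s. super_strong_eq N s})"

section \<open>Well-definedness\<close>

lemma finite_creditors: "finite (creditors N i)"
  unfolding creditors_def by simp

lemma finite_strategies: "finite (strategies N i)"
proof -
  let ?A = "Pow (creditors N i)"
  have "strategies N i \<subseteq> {ss. set ss \<subseteq> ?A \<and> length ss \<le> card ?A}"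
  proof
    fix ss assume "ss \<in> strategies N i"
    hence d: "distinct ss" and p: "partition_on (creditors N i) (set ss)"
      by (auto simp: strategies_def)
    have sub: "set ss \<subseteq> ?A" using p by (auto simp: partition_on_def)
    moreover have "length ss \<le> card ?A"
      using card_mono[OF _ sub] d finite_creditors[of N i] by (simp add: distinct_card)
    ultimately show "ss \<in> {ss. set ss \<subseteq> ?A \<and> length ss \<le> card ?A}" by simp
  qed
  moreover have "finite {ss. set ss \<subseteq> ?A \<and> length ss \<le> card ?A}"
    using finite_creditors[of N i] by (intro finite_lists_length_le) simp
  ultimately show ?thesis by (rule finite_subset)
qed

lemma finite_profiles: "finite (profiles N)"
  unfolding profiles_def by (intro finite_PiE finite_strategies) simp

lemma profiles_nonempty: "profiles N \<noteq> {}"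
proof -
  have "\<exists>ss. ss \<in> strategies N i" for i
  proof (cases "creditors N i = {}")
    case True
    then show ?thesis by (intro exI[of _ "[]"]) (simp add: strategies_def partition_on_def)
  next
    case False
    then show ?thesis
      by (intro exI[of _ "[creditors N i]"]) (auto simp: strategies_def partition_on_def)
  qed
  thus ?thesis unfolding profiles_def PiE_eq_empty_iff by auto
qed

lemma class_idx_eq:
  assumes "ss \<in> strategies N i" "m < length ss" "j \<in> ss ! m"
  shows "class_idx ss j = m"
  unfolding class_idx_def
proof (rule the_equality)
  show "m < length ss \<and> j \<in> ss ! m" using assms by simp
  fix m' assume m': "m' < length ss \<and> j \<in> ss ! m'"
  have "disjoint (set ss)" "distinct ss"
    using assms by (auto simp: strategies_def partition_on_def)
  moreover have "ss ! m \<in> set ss" "ss ! m' \<in> set ss" using assms m' by auto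
  ultimately have "ss ! m' = ss ! m" using m' assms(3) unfolding disjoint_def by blast
  thus "m' = m" using \<open>distinct ss\<close> m' assms(2) by (simp add: nth_eq_iff_index_eq)
qed

lemma sum_classes:
  assumes "ss \<in> strategies N i"
  shows "(\<Sum>j\<in>creditors N i. f j) = (\<Sum>m<length ss. \<Sum>j\<in>ss ! m. f j :: real)"
proof -
  have p: "partition_on (creditors N i) (set ss)" and d: "distinct ss"
    using assms by (auto simp: strategies_def)
  have U: "creditors N i = \<Union>(set ss)" and dj: "disjoint (set ss)"
    using p by (auto simp: partition_on_def)
  have fin: "finite A" if "A \<in> set ss" for A
    using that U finite_creditors[of N i] by (metis Sup_upper finite_subset)
  have "(\<Sum>j\<in>creditors N i. f j) = (\<Sum>A\<in>set ss. sum f A)"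
    unfolding U using fin dj
    by (subst sum.Union_disjoint) (auto simp: disjoint_def)
  also have "\<dots> = (\<Sum>m<length ss. sum f (ss ! m))"
    by (rule sum.reindex_bij_betw[symmetric]) (rule bij_betw_nth[OF d refl refl])
  finally show ?thesis .
qed

lemma total_liab_creditors:
  assumes "financial_network N" "i < firms N"
  shows "total_liab N i = (\<Sum>j\<in>creditors N i. liab N i j)"
  unfolding total_liab_def
proof (rule sum.mono_neutral_right)
  show "\<forall>j\<in>{..<firms N} - creditors N i. liab N i j = 0"
    using assms unfolding financial_network_def creditors_def
    by (metis (no_types, lifting) DiffE lessThan_iff mem_Collect_eq order_le_less)
qed (auto simp: creditors_def)

lemma strategy_class:
  assumes "ss \<in> strategies N i" "m < length ss"
  shows "ss ! m \<subseteq> creditors N i" "ss ! m \<noteq> {}" "0 < class_liab N i ss m"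
proof -
  have p: "partition_on (creditors N i) (set ss)" and mem: "ss ! m \<in> set ss"
    using assms by (auto simp: strategies_def)
  show sub: "ss ! m \<subseteq> creditors N i" and ne: "ss ! m \<noteq> {}"
    using p mem by (auto simp: partition_on_def)
  show "0 < class_liab N i ss m" unfolding class_liab_def
    using sub ne finite_subset[OF sub finite_creditors]
    by (intro sum_pos) (auto simp: creditors_def)
qed

lemma strategy_class_obtain:
  assumes "ss \<in> strategies N i" "j \<in> creditors N i"
  obtains m where "m < length ss" "j \<in> ss ! m" "class_idx ss j = m"
proof -
  have "\<exists>A\<in>set ss. j \<in> A" using assms by (auto simp: strategies_def partition_on_def)
  then obtain m where "m < length ss" "j \<in> ss ! m" by (metis in_set_conv_nth)
  thus thesis using that class_idx_eq[OF assms(1)] by blast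
qed

lemma allocation_bounds:
  assumes "j \<in> creditors N i"
  shows "0 \<le> allocation N i ss p j" "allocation N i ss p j \<le> liab N i j"
  using assms by (auto simp: allocation_def creditors_def)

lemma allocation_mono:
  assumes "ss \<in> strategies N i" "j \<in> creditors N i" "p \<le> q"
  shows "allocation N i ss p j \<le> allocation N i ss q j"
proof -
  obtain m where m: "m < length ss" "class_idx ss j = m"
    using strategy_class_obtain[OF assms(1,2)] by metis
  have "0 \<le> liab N i j / class_liab N i ss m"
    using strategy_class(3)[OF assms(1) m(1)] assms(2) by (auto simp: creditors_def)
  thus ?thesis unfolding allocation_def m(2)
    by (intro min.mono max.mono mult_right_mono) (use assms(3) in auto)
qed

lemma sum_allocation:
  assumes ss: "ss \<in> strategies N i" and net: "financial_network N" "i < firms N"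
    and p: "0 \<le> p" "p \<le> total_liab N i"
  shows "(\<Sum>j\<in>creditors N i. allocation N i ss p j) = p"
proof -
  let ?S = "\<lambda>k. \<Sum>m<k. class_liab N i ss m"
  have cls: "(\<Sum>j\<in>ss ! m. allocation N i ss p j) = min (max (p - ?S m) 0) (class_liab N i ss m)"
    if m: "m < length ss" for m
  proof -
    let ?L = "class_liab N i ss m"
    have L: "0 < ?L" by (rule strategy_class(3)[OF ss m])
    let ?t = "min (max ((p - ?S m) / ?L) 0) 1"
    have "allocation N i ss p j = ?t * liab N i j" if j: "j \<in> ss ! m" for j
    proof -
      have "j \<in> creditors N i" using strategy_class(1)[OF ss m] j by auto
      hence l: "0 < liab N i j" by (auto simp: creditors_def)
      have "allocation N i ss p j = min (max ((p - ?S m) / ?L * liab N i j) 0) (liab N i j)"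
        unfolding allocation_def class_idx_eq[OF ss m j] by simp
      also have "\<dots> = ?t * liab N i j"
        using l by (simp add: min_mult_distrib_right max_mult_distrib_right)
      finally show ?thesis .
    qed
    hence "(\<Sum>j\<in>ss ! m. allocation N i ss p j) = ?t * ?L"
      unfolding class_liab_def by (simp add: sum_distrib_left)
    also have "\<dots> = min (max (p - ?S m) 0) ?L"
      using L by (simp add: min_mult_distrib_right max_mult_distrib_right)
    finally show ?thesis .
  qed
  have tele: "(\<Sum>m<k. min (max (p - ?S m) 0) (class_liab N i ss m)) = min p (?S k)"
    if "k \<le> length ss" for k
    using that
  proof (induction k)
    case 0
    then show ?case using p by simp
  next
    case (Suc k)
    have "0 < class_liab N i ss k" using Suc.prems by (intro strategy_class(3)[OF ss]) simp
    thus ?case using Suc by (auto simp: min_def max_def)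
  qed
  have "?S (length ss) = total_liab N i"
    unfolding total_liab_creditors[OF net] sum_classes[OF ss] class_liab_def ..
  thus ?thesis using p cls tele[of "length ss"] unfolding sum_classes[OF ss] by simp
qed

theorem ex1_max_clearing:
  assumes net: "financial_network N" and s: "s \<in> profiles N"
  shows "\<exists>!P. is_max_clearing N s P"
proof -
  let ?n = "firms N"
  define pay where "pay P i =
    (if total_liab N i \<le> assets N P i then total_liab N i else max 0 (assets N P i))" for P i
  define F where "F P i j = (if i < ?n \<and> j < ?n \<and> j \<in> creditors N i
    then allocation N i (s i) (pay P i) j else 0)" for P i j
  have si: "s i \<in> strategies N i" if "i < ?n" for i
    using s that by (auto simp: profiles_def)
  have L0: "0 \<le> total_liab N i" if "i < ?n" for i
    using net that by (auto simp: total_liab_def financial_network_def intro: sum_nonneg)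
  have F_bd: "0 \<le> F P i j" "F P i j \<le> \<bar>liab N i j\<bar>" for P i j
    using allocation_bounds[of j N i "s i" "pay P i"] by (auto simp: F_def creditors_def)
  have pay_mono: "pay P i \<le> pay Q i" if "\<And>i j. P i j \<le> Q i j" "i < ?n" for P Q i
  proof -
    have "assets N P i \<le> assets N Q i"
      using that(1) by (auto simp: assets_def intro: sum_mono)
    thus ?thesis using L0[OF that(2)] by (auto simp: pay_def)
  qed
  have F_mono: "F P i j \<le> F Q i j" if "\<And>i j. P i j \<le> Q i j" for P Q i j
    using pay_mono[OF that] allocation_mono[OF si] by (auto simp: F_def)
  have F_sum: "outgoing N (F P) i = pay P i" if i: "i < ?n" for P i
  proof -
    have "outgoing N (F P) i = (\<Sum>j\<in>creditors N i. allocation N i (s i) (pay P i) j)"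
      unfolding outgoing_def F_def using i
      by (intro sum.mono_neutral_cong_right) (auto simp: creditors_def)
    also have "\<dots> = pay P i"
      using L0[OF i] by (intro sum_allocation si net i) (auto simp: pay_def)
    finally show ?thesis .
  qed
  have clear_iff: "clearing N s P \<longleftrightarrow> F P = P" for P
  proof
    assume c: "clearing N s P"
    show "F P = P"
    proof (intro ext)
      fix i j show "F P i j = P i j"
        using c unfolding clearing_def F_def pay_def
        by (cases "i < ?n \<and> j < ?n") auto
    qed
  next
    assume eq: "F P = P"
    have out: "outgoing N P i = pay P i" if "i < ?n" for i using F_sum[OF that, of P] eq by simp
    have ent: "P i j = (if i < ?n \<and> j < ?n \<and> j \<in> creditors N i
        then allocation N i (s i) (pay P i) j else 0)" for i j
      using fun_cong[OF fun_cong[OF eq]] unfolding F_def by metis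
    have "P i i = 0" if "i < ?n" for i
      using net that ent[of i i] by (auto simp: financial_network_def creditors_def)
    moreover have "0 \<le> P i j \<and> P i j \<le> liab N i j" if "i < ?n" "j < ?n" for i j
      using F_bd[of P i j] eq net that by (auto simp: financial_network_def)
    ultimately show "clearing N s P"
      unfolding clearing_def using out ent by (auto simp: pay_def)
  qed
  define S where "S = {P. (\<forall>i j. 0 \<le> P i j \<and> P i j \<le> F P i j) \<and> proper N P}"
  have z: "(\<lambda>i j. 0) \<in> S" using F_bd by (auto simp: S_def proper_def outgoing_def)
  define M where "M i j = (SUP P\<in>S. P i j)" for i j
  have bdd: "bdd_above ((\<lambda>P. P i j) ` S)" for i j
    by (rule bdd_aboveI[of _ "\<bar>liab N i j\<bar>"]) (auto simp: S_def intro: order_trans[OF _ F_bd(2)])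
  have M_ub: "P i j \<le> M i j" if "P \<in> S" for P i j
    unfolding M_def by (rule cSUP_upper[OF that bdd])
  have M0: "0 \<le> M i j" for i j using M_ub[OF z] by simp
  have M_F: "M i j \<le> F M i j" for i j
    unfolding M_def
  proof (rule cSUP_least)
    fix P assume P: "P \<in> S"
    have "P i j \<le> F P i j" using P by (simp add: S_def)
    also have "\<dots> \<le> F M i j" by (rule F_mono) (rule M_ub[OF P])
    finally show "P i j \<le> F (\<lambda>i j. SUP P\<in>S. P i j) i j" by (simp add: M_def[abs_def])
  qed (use z in auto)
  have reach_mono: "(k, i) \<in> (pay_edges N Q)\<^sup>*"
    if "(k, i) \<in> (pay_edges N P)\<^sup>*" "\<And>i j. P i j \<le> Q i j" for P Q k i
  proof -
    have "pay_edges N P \<subseteq> pay_edges N Q"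
      using that(2) by (auto simp: pay_edges_def intro: less_le_trans)
    thus ?thesis using that(1) rtrancl_mono by blast
  qed
  have pos: "\<exists>j<?n. 0 < Q i j" if "0 < outgoing N Q i" for Q i
  proof (rule ccontr)
    assume "\<not> (\<exists>j<?n. 0 < Q i j)"
    hence "outgoing N Q i \<le> 0" unfolding outgoing_def by (intro sum_nonpos) auto
    thus False using that by simp
  qed
  have M_proper: "\<exists>k<?n. 0 < ext N k \<and> (k, i) \<in> (pay_edges N M)\<^sup>*"
    if i: "i < ?n" and j: "j < ?n" "0 < M i j" for i j
  proof -
    obtain P where P: "P \<in> S" "0 < P i j"
      using j(2) less_cSUP_iff[of S "\<lambda>P. P i j" 0] bdd z unfolding M_def by auto
    have "P i j \<le> outgoing N P i" unfolding outgoing_def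
      using P(1) j by (intro member_le_sum) (auto simp: S_def)
    hence "0 < outgoing N P i" using P(2) by simp
    then obtain k where "k < ?n" "0 < ext N k" "(k, i) \<in> (pay_edges N P)\<^sup>*"
      using P(1) i by (auto simp: S_def proper_def)
    thus ?thesis using reach_mono M_ub[OF P(1)] by blast
  qed
  have FM: "F M \<in> S"
  proof -
    have "proper N (F M)" unfolding proper_def
    proof (intro allI impI)
      fix i assume i: "i < ?n" "0 < outgoing N (F M) i"
      hence "0 < pay M i" using F_sum by simp
      hence a: "0 < assets N M i" using i by (auto simp: pay_def split: if_splits)
      show "\<exists>k<?n. 0 < ext N k \<and> (k, i) \<in> (pay_edges N (F M))\<^sup>*"
      proof (cases "0 < ext N i")
        case True
        then show ?thesis using i by blast
      next
        case False
        have "\<exists>h<?n. 0 < M h i"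
        proof (rule ccontr)
          assume "\<not> (\<exists>h<?n. 0 < M h i)"
          hence "(\<Sum>h<?n. M h i) \<le> 0" by (intro sum_nonpos) auto
          thus False using a False by (simp add: assets_def)
        qed
        then obtain h where h: "h < ?n" "0 < M h i" by blast
        obtain k where k: "k < ?n" "0 < ext N k" "(k, h) \<in> (pay_edges N M)\<^sup>*"
          using M_proper[OF h(1) i(1) h(2)] by blast
        have "(h, i) \<in> pay_edges N M" using h i by (simp add: pay_edges_def)
        hence "(k, i) \<in> (pay_edges N M)\<^sup>*" using k(3) by simp
        hence "(k, i) \<in> (pay_edges N (F M))\<^sup>*" by (rule reach_mono) (rule M_F)
        thus ?thesis using k by blast
      qed
    qed
    thus ?thesis using F_bd(1) F_mono[OF M_F] by (auto simp: S_def)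
  qed
  have fixM: "F M = M" by (intro ext antisym M_ub[OF FM] M_F)
  have in_S: "Q \<in> S" if "clearing N s Q" "proper N Q" for Q
    using that F_bd(1)[of Q] clear_iff[of Q] by (auto simp: S_def)
  have "is_max_clearing N s M"
    unfolding is_max_clearing_def
    using fixM clear_iff FM M_ub in_S by (auto simp: S_def)
  moreover have "P = Q" if "is_max_clearing N s P" "is_max_clearing N s Q" for P Q
    using that unfolding is_max_clearing_def by (intro ext antisym) blast+
  ultimately show ?thesis by blast
qed

corollary payments_max_clearing:
  assumes "financial_network N" "s \<in> profiles N"
  shows "is_max_clearing N s (payments N s)"
  unfolding payments_def by (rule theI'[OF ex1_max_clearing[OF assms]])

end

theory Submission
  imports Defs
begin

text \<open>Firms 0 and 2 owe money to each other; firm 0 also owes \<open>M\<close> to firm 1, which only repays an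
  outside debt of \<open>M\<close>, and firm 2 also owes money to firm 3, which has an outside debt of 1. If
  firm 0 pays firm 1 first and firm 2 pays firm 0 first, the money left after paying firm 1
  circulates until firm 0 is solvent with equity 1, at the price of losing \<open>M\<close> outside. Firm 2
  never has positive equity, so in every super-strong equilibrium firm 0 has equity 1, and then
  nothing is left for the others. As long as firm 0 pays firm 1 first, firm 3 gains nothing, so
  this is indeed an equilibrium. The optimum moves all the money to firm 3, for a welfare of \<open>M\<close>.\<close>

definition leaky_cycle :: "real \<Rightarrow> network" where
  "leaky_cycle M =
     \<lparr>firms = 4,
      ext = (\<lambda>i. if i = 0 then M + 1 else if i = 1 then - M else if i = 3 then - 1 else 0),
      liab = (\<lambda>i j. if i = 0 \<and> j = 1 then M
                    else if (i = 0 \<and> j = 2) \<or> (i = 2 \<and> (j = 0 \<or> j = 3)) then M + 1 else 0)\<rparr>"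

section \<open>Priority lists of two creditors\<close>

text \<open>Nothing ranks above \<open>a\<close>, and in its own class its share is 1. The payment
  to \<open>b\<close> is never computed this way: it is the rest of the outgoing payment.\<close>

lemma allocation_first_singleton:
  assumes "a \<noteq> b" "liab N i a \<noteq> 0"
  shows "allocation N i [{a}, {b}] p a = min (max p 0) (liab N i a)"
proof -
  have "class_idx [{a}, {b}] a = 0"
    unfolding class_idx_def
    by (rule the_equality) (use assms(1) in \<open>auto simp: nth_Cons' split: if_splits\<close>)
  then show ?thesis
    using assms(2) by (simp add: allocation_def class_liab_def)
qed

lemma two_singletons_strategy:
  assumes "a \<noteq> b" "creditors N i = {a, b}"
  shows "[{a}, {b}] \<in> strategies N i"
  using assms by (auto simp: strategies_def partition_on_def disjoint_def)

lemma less_four_iff: "i < 4 \<longleftrightarrow> i = 0 \<or> i = 1 \<or> i = 2 \<or> i = (3::nat)"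
  by auto

lemma sum_less_four: "(\<Sum>i<4. f i) = f 0 + f 1 + f 2 + f 3" for f :: "nat \<Rightarrow> real"
  by (simp add: numeral_eq_Suc)

section \<open>Payments and utilities in the leaky cycle\<close>

context
  fixes M :: real
  assumes M: "M > 0"
begin

lemma leaky_cycle_network: "financial_network (leaky_cycle M)"
  using M by (auto simp: financial_network_def leaky_cycle_def)

lemma leaky_cycle_creditors:
  "creditors (leaky_cycle M) 0 = {1, 2}" "creditors (leaky_cycle M) 2 = {0, 3}"
  "creditors (leaky_cycle M) 1 = {}" "creditors (leaky_cycle M) 3 = {}"
  using M by (auto simp: creditors_def leaky_cycle_def)

text \<open>Firms 1 and 3 have no creditors, so only coordinates 0 and 2 offer a choice. Updating a
  given profile inherits everything else.\<close>

lemma leaky_cycle_update_profile: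
  assumes s: "s \<in> profiles (leaky_cycle M)"
    and a: "a = [{1}, {2}] \<or> a = [{2}, {1}]" and b: "b = [{0}, {3}] \<or> b = [{3}, {0}]"
  shows "s(0 := a, 2 := b) \<in> profiles (leaky_cycle M)"
proof -
  have "a \<in> strategies (leaky_cycle M) 0" "b \<in> strategies (leaky_cycle M) 2"
    using a b leaky_cycle_creditors by (auto intro!: two_singletons_strategy)
  moreover have "firms (leaky_cycle M) = 4" by (simp add: leaky_cycle_def)
  ultimately show ?thesis
    using s by (auto simp: profiles_def PiE_iff extensional_def)
qed

text \<open>Reduces the game to piecewise linear constraints on four payments, so that linear
  arithmetic settles what follows. The last four facts depend on the strategies, the others hold for
  every profile.\<close>

lemma leaky_cycle_clearing:
  assumes s: "s \<in> profiles (leaky_cycle M)"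
  defines "P \<equiv> payments (leaky_cycle M) s"
  shows "0 \<le> P 0 1" "P 0 1 \<le> M" "0 \<le> P 0 2" "P 0 2 \<le> M + 1"
    and "0 \<le> P 2 0" "P 2 0 \<le> M + 1" "0 \<le> P 2 3" "P 2 3 \<le> M + 1"
    and "P 0 1 + P 0 2 = min (2 * M + 1) (M + 1 + P 2 0)"
    and "P 2 0 + P 2 3 = P 0 2"
    and "utility (leaky_cycle M) s 0 = max 0 (P 2 0 - M)"
    and "utility (leaky_cycle M) s 1 = 0"
    and "utility (leaky_cycle M) s 2 = 0"
    and "utility (leaky_cycle M) s 3 = max 0 (P 2 3 - 1)"
    and "social_welfare (leaky_cycle M) P = max 0 (P 2 0 - M) + max 0 (P 2 3 - 1)"
    and "s 0 = [{1}, {2}] \<Longrightarrow> P 0 1 = min (P 0 1 + P 0 2) M"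
    and "s 0 = [{2}, {1}] \<Longrightarrow> P 0 2 = min (P 0 1 + P 0 2) (M + 1)"
    and "s 2 = [{0}, {3}] \<Longrightarrow> P 2 0 = min (P 2 0 + P 2 3) (M + 1)"
    and "s 2 = [{3}, {0}] \<Longrightarrow> P 2 3 = min (P 2 0 + P 2 3) (M + 1)"
proof -
  let ?N = "leaky_cycle M"
  have c: "clearing ?N s P"
    using payments_max_clearing[OF leaky_cycle_network s] by (simp add: is_max_clearing_def P_def)
  have n: "firms ?N = 4" by (simp add: leaky_cycle_def)
  have bounds: "0 \<le> P i j \<and> P i j \<le> liab ?N i j" if "i < 4" "j < 4" for i j
    using c that unfolding clearing_def n by blast
  show b: "0 \<le> P 0 1" "P 0 1 \<le> M" "0 \<le> P 0 2" "P 0 2 \<le> M + 1"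
    "0 \<le> P 2 0" "P 2 0 \<le> M + 1" "0 \<le> P 2 3" "P 2 3 \<le> M + 1"
    using bounds[of 0 1] bounds[of 0 2] bounds[of 2 0] bounds[of 2 3]
    by (simp_all add: leaky_cycle_def)
  have z: "P 0 0 = 0" "P 0 3 = 0" "P 1 0 = 0" "P 1 1 = 0" "P 1 2 = 0" "P 1 3 = 0"
    "P 2 1 = 0" "P 2 2 = 0" "P 3 0 = 0" "P 3 1 = 0" "P 3 2 = 0" "P 3 3 = 0"
    using bounds[of 0 0] bounds[of 0 3] bounds[of 1 0] bounds[of 1 1] bounds[of 1 2] bounds[of 1 3]
      bounds[of 2 1] bounds[of 2 2] bounds[of 3 0] bounds[of 3 1] bounds[of 3 2] bounds[of 3 3]
    by (simp_all add: leaky_cycle_def)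
  have out: "outgoing ?N P 0 = P 0 1 + P 0 2" "outgoing ?N P 2 = P 2 0 + P 2 3"
    using z by (simp_all add: outgoing_def n sum_less_four)
  have ass: "assets ?N P 0 = M + 1 + P 2 0" "assets ?N P 1 = P 0 1 - M"
    "assets ?N P 2 = P 0 2" "assets ?N P 3 = P 2 3 - 1"
    using z by (simp_all add: assets_def n sum_less_four) (simp_all add: leaky_cycle_def)
  \<comment> \<open>The outside debts of firms 1 and 3 count as negative assets, not as
    liabilities.\<close>
  have tot: "total_liab ?N 0 = 2 * M + 1" "total_liab ?N 1 = 0"
    "total_liab ?N 2 = 2 * M + 2" "total_liab ?N 3 = 0"
    by (simp_all add: total_liab_def n sum_less_four) (simp_all add: leaky_cycle_def)
  have pay: "outgoing ?N P i =
      (if total_liab ?N i \<le> assets ?N P i then total_liab ?N i else max 0 (assets ?N P i))"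
    if "i < 4" for i
    using c that unfolding clearing_def n by blast
  show "P 0 1 + P 0 2 = min (2 * M + 1) (M + 1 + P 2 0)"
    using pay[of 0] b M by (auto simp: out ass tot)
  \<comment> \<open>Firm 2 owes 2M + 2 but receives at most M + 1, so it passes on all it
    gets.\<close>
  show "P 2 0 + P 2 3 = P 0 2"
    using pay[of 2] b M by (auto simp: out ass tot)
  have E: "equity ?N P 0 = max 0 (P 2 0 - M)" "equity ?N P 1 = 0" "equity ?N P 2 = 0"
    "equity ?N P 3 = max 0 (P 2 3 - 1)"
    using b M by (auto simp: equity_def ass tot simp del: One_nat_def)
  show "utility ?N s 0 = max 0 (P 2 0 - M)" "utility ?N s 1 = 0" "utility ?N s 2 = 0"
    "utility ?N s 3 = max 0 (P 2 3 - 1)"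
    using E by (simp_all add: utility_def P_def)
  show "social_welfare ?N P = max 0 (P 2 0 - M) + max 0 (P 2 3 - 1)"
    using E by (simp add: social_welfare_def n sum_less_four)
  have alloc: "P i j = allocation ?N i (s i) (outgoing ?N P i) j"
    if "i < 4" "j \<in> creditors ?N i" for i j
  proof -
    have "j < 4" using that(2) by (simp add: creditors_def n)
    then show ?thesis using c that unfolding clearing_def n by metis
  qed
  have first: "P i a = min (outgoing ?N P i) (liab ?N i a)"
    if "s i = [{a}, {b}]" "i < 4" "a \<noteq> b" "a \<in> creditors ?N i" for i a b
  proof -
    have "0 \<le> outgoing ?N P i"
      using that(2) bounds by (auto simp: outgoing_def n intro!: sum_nonneg)
    moreover have "liab ?N i a \<noteq> 0" using that(4) by (simp add: creditors_def)
    ultimately show ?thesis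
      using alloc[OF that(2,4)] that(1,3) by (simp add: allocation_first_singleton)
  qed
  have l: "liab ?N 0 1 = M" "liab ?N 0 2 = M + 1" "liab ?N 2 0 = M + 1" "liab ?N 2 3 = M + 1"
    by (simp_all add: leaky_cycle_def)
  show "P 0 1 = min (P 0 1 + P 0 2) M" if "s 0 = [{1}, {2}]"
    using first[OF that] by (simp add: leaky_cycle_creditors out l del: One_nat_def)
  show "P 0 2 = min (P 0 1 + P 0 2) (M + 1)" if "s 0 = [{2}, {1}]"
    using first[OF that] by (simp add: leaky_cycle_creditors out l del: One_nat_def)
  show "P 2 0 = min (P 2 0 + P 2 3) (M + 1)" if "s 2 = [{0}, {3}]"
    using first[OF that] by (simp add: leaky_cycle_creditors out l del: One_nat_def)
  show "P 2 3 = min (P 2 0 + P 2 3) (M + 1)" if "s 2 = [{3}, {0}]"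
    using first[OF that] by (simp add: leaky_cycle_creditors out l del: One_nat_def)
qed

text \<open>Equity 1 for firm 0 forces \<open>P 2 0\<close> = M + 1, the most firm 2 can ever
  receive, so \<open>P 2 3\<close> = 0.\<close>

lemma leaky_cycle_utility_0_ge_1:
  assumes s: "s \<in> profiles (leaky_cycle M)" and "1 \<le> utility (leaky_cycle M) s 0"
  shows "utility (leaky_cycle M) s 0 = 1" "utility (leaky_cycle M) s 3 = 0"
    and "social_welfare (leaky_cycle M) (payments (leaky_cycle M) s) = 1"
  using leaky_cycle_clearing(1-15)[OF s] assms(2) by auto

text \<open>Firm 0 can always pay M to firm 1, so \<open>P 0 2\<close> is at most 1 +
  \<open>P 2 0\<close>. Firm 3 thus gets at most 1, which its outside debt absorbs.\<close>

lemma leaky_cycle_utility_3_eq_0: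
  assumes s: "s \<in> profiles (leaky_cycle M)" and "s 0 = [{1}, {2}]"
  shows "utility (leaky_cycle M) s 3 = 0"
  using leaky_cycle_clearing(1-14)[OF s] leaky_cycle_clearing(16)[OF s assms(2)] M by linarith

text \<open>Here x = \<open>P 2 0\<close> = \<open>P 0 2\<close> satisfies x = min (M + 1) (1 + x),
  whose only solution is M + 1.\<close>

lemma leaky_cycle_utility_0_eq_1:
  assumes s: "s \<in> profiles (leaky_cycle M)" and "s 0 = [{1}, {2}]" "s 2 = [{0}, {3}]"
  shows "utility (leaky_cycle M) s 0 = 1"
  using leaky_cycle_clearing(1-14)[OF s] leaky_cycle_clearing(16)[OF s assms(2)]
    leaky_cycle_clearing(18)[OF s assms(3)] M by linarith

text \<open>The external assets of firm 0 cover its debt to firm 2, which hands all M + 1 to firm 3;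
  the outside debt takes 1.\<close>

lemma leaky_cycle_welfare_eq:
  assumes s: "s \<in> profiles (leaky_cycle M)" and "s 0 = [{2}, {1}]" "s 2 = [{3}, {0}]"
  shows "social_welfare (leaky_cycle M) (payments (leaky_cycle M) s) = M"
  using leaky_cycle_clearing(1-15)[OF s] leaky_cycle_clearing(17)[OF s assms(2)]
    leaky_cycle_clearing(19)[OF s assms(3)] M by linarith

section \<open>Optimum, equilibria and price of stability\<close>

lemma leaky_cycle_opt_welfare: "M \<le> opt_welfare (leaky_cycle M)"
proof -
  obtain s where s: "s \<in> profiles (leaky_cycle M)" using profiles_nonempty by blast
  let ?s = "s(0 := [{2}, {1}], 2 := [{3}, {0}])"
  have p: "?s \<in> profiles (leaky_cycle M)" by (intro leaky_cycle_update_profile s) auto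
  then have "social_welfare (leaky_cycle M) (payments (leaky_cycle M) ?s) = M"
    by (rule leaky_cycle_welfare_eq) auto
  then show ?thesis
    unfolding opt_welfare_def using p
    by (intro Max_ge finite_imageI finite_profiles image_eqI[where x = ?s]) auto
qed

lemma leaky_cycle_equilibrium_exists: "\<exists>s. super_strong_eq (leaky_cycle M) s"
proof -
  let ?N = "leaky_cycle M"
  obtain t where "t \<in> profiles ?N" using profiles_nonempty by blast
  define s where "s = t(0 := [{1}, {2}], 2 := [{0}, {3}])"
  have p: "s \<in> profiles ?N"
    unfolding s_def by (intro leaky_cycle_update_profile) (use \<open>t \<in> profiles ?N\<close> in auto)
  have s0: "s 0 = [{1}, {2}]" and s2: "s 2 = [{0}, {3}]" by (simp_all add: s_def)
  have u0: "utility ?N s 0 = 1" by (rule leaky_cycle_utility_0_eq_1[OF p s0 s2])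
  have False
    if C: "C \<subseteq> {..<firms ?N}" and s': "s' \<in> profiles ?N"
      and out: "\<forall>i<firms ?N. i \<notin> C \<longrightarrow> s' i = s i"
      and inc: "\<exists>i\<in>C. utility ?N s i < utility ?N s' i"
      and nodec: "\<forall>i\<in>C. utility ?N s i \<le> utility ?N s' i" for C s'
  proof -
    obtain i where i: "i \<in> C" "utility ?N s i < utility ?N s' i" using inc by blast
    have n: "firms ?N = 4" by (simp add: leaky_cycle_def)
    have nonneg: "0 \<le> utility ?N s i" by (simp add: utility_def equity_def)
    \<comment> \<open>Either firm 0 is in the coalition and must keep equity 1, or it still pays
      firm 1 first; both leave firm 3 with nothing.\<close>
    have u3: "utility ?N s' 3 = 0"
    proof (cases "0 \<in> C")
      case True
      then have "1 \<le> utility ?N s' 0" using nodec u0 by force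
      then show ?thesis by (rule leaky_cycle_utility_0_ge_1(2)[OF s'])
    next
      case False
      then have "s' 0 = [{1}, {2}]" using out s0 n by auto
      then show ?thesis by (rule leaky_cycle_utility_3_eq_0[OF s'])
    qed
    have "i = 0 \<or> i = 1 \<or> i = 2 \<or> i = 3"
      using C i(1) less_four_iff[of i] n by auto
    then have "i = 0"
      using i(2) nonneg u3 leaky_cycle_clearing(12,13)[OF s'] by (elim disjE) simp_all
    then show False
      using i u0 leaky_cycle_utility_0_ge_1(1)[OF s'] by auto
  qed
  then have "super_strong_eq ?N s" unfolding super_strong_eq_def using p by blast
  then show ?thesis by blast
qed

lemma leaky_cycle_equilibrium_welfare:
  assumes s: "super_strong_eq (leaky_cycle M) s"
  shows "social_welfare (leaky_cycle M) (payments (leaky_cycle M) s) = 1"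
proof -
  let ?N = "leaky_cycle M" and ?s = "s(0 := [{1}, {2}], 2 := [{0}, {3}])"
  have p: "s \<in> profiles ?N" using s by (simp add: super_strong_eq_def)
  have p': "?s \<in> profiles ?N" by (intro leaky_cycle_update_profile p) auto
  have u0: "utility ?N ?s 0 = 1" by (rule leaky_cycle_utility_0_eq_1[OF p']) auto
  have "1 \<le> utility ?N s 0"
  \<comment> \<open>Otherwise firms 0 and 2 deviate jointly: firm 2 stays at equity 0, which a
    super-strong deviation permits.\<close>
  proof (rule ccontr)
    assume less: "\<not> 1 \<le> utility ?N s 0"
    have "{0, 2} \<subseteq> {..<firms ?N}" by (simp add: leaky_cycle_def)
    moreover have "\<forall>i<firms ?N. i \<notin> {0, 2} \<longrightarrow> ?s i = s i" by simp
    moreover have "\<exists>i\<in>{0, 2}. utility ?N s i < utility ?N ?s i" using less u0 by auto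
    moreover have "\<forall>i\<in>{0, 2}. utility ?N s i \<le> utility ?N ?s i"
      using less u0 leaky_cycle_clearing(13)[OF p] leaky_cycle_clearing(13)[OF p'] by auto
    ultimately show False using s p' unfolding super_strong_eq_def by blast
  qed
  then show ?thesis by (rule leaky_cycle_utility_0_ge_1(3)[OF p])
qed

lemma leaky_cycle_price_of_stability: "ereal M \<le> price_of_stability (leaky_cycle M)"
  unfolding price_of_stability_def
proof (rule Min.boundedI)
  have "finite {s. super_strong_eq (leaky_cycle M) s}"
    by (rule finite_subset[OF _ finite_profiles]) (auto simp: super_strong_eq_def)
  then show "finite ((\<lambda>s. welfare_ratio (opt_welfare (leaky_cycle M))
      (social_welfare (leaky_cycle M) (payments (leaky_cycle M) s))) `
        {s. super_strong_eq (leaky_cycle M) s})"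
    by (rule finite_imageI)
\<comment> \<open>Equilibrium welfare is 1, so every ratio equals the optimum.\<close>
qed (use leaky_cycle_equilibrium_exists leaky_cycle_opt_welfare in
      \<open>auto simp: leaky_cycle_equilibrium_welfare welfare_ratio_def\<close>)

end

theorem theorem18:
  fixes R :: real
  assumes "R > 0"
  shows "\<exists>N. financial_network N \<and> (\<exists>s. super_strong_eq N s) \<and> ereal R \<le> price_of_stability N"
  \<comment> \<open>The witness is the leaky cycle with M = R.\<close>
  using leaky_cycle_network[OF assms] leaky_cycle_equilibrium_exists[OF assms]
    leaky_cycle_price_of_stability[OF assms] by blast

end
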